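(* Let $n,d\ge1$ and $p\ge 2d+1$. Let $\Delta\in\mathbb{R}^{nd\times nd}$ be symmetric with $d\times d$ blocks, $\Delta_{ii}=0$, $Z^{\top}=[I_d,\dots,I_d]$, $A=ZZ^{\top}+\Delta$, and $f(S)=\langle A,SS^{\top}\rangle$ on $\{S\in\mathbb{R}^{nd\times p}:S_iS_i^{\top}=I_d\ \forall i\}$. Then every second-order critical point $S$ of $f$ satisfies \[ d_F(S,Z)\le\delta\sqrt{\frac dn}\,\|\Delta\|_{\mathrm{op}},\qquad \delta=\frac{(2+\sqrt5)(p+d)\gamma}{p-2d},\qquad \gamma=\frac{\|\mathrm{Tr}_d(\Delta)\|_{\mathrm{op}}}{\|\Delta\|_{\mathrm{op}}}\vee1, \] where $\mathrm{Tr}_d(\Delta)=[\mathrm{Tr}(\Delta_{ij})]_{i,j}\in\mathbb{R}^{n\times n}$ is the partial trace of $\Delta$.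
   Context: $S_i$ is the $i$-th $d\times p$ block of $S$; $\langle X,Y\rangle=\mathrm{Tr}(XY^{\top})$; $A_{ij}=I_d+\Delta_{ij}$. Put $\Lambda_{ii}=\frac12\sum_{j}(S_iS_j^{\top}A_{ji}+A_{ij}S_jS_i^{\top})$ and $T_{S_i}=\{Y\in\mathbb{R}^{d\times p}:S_iY^{\top}+YS_i^{\top}=0\}$. $S$ is a second-order critical point of $f$ if $\sum_jA_{ij}S_j=\Lambda_{ii}S_i$ for all $i$ and $\sum_i\langle\Lambda_{ii},\dot S_i\dot S_i^{\top}\rangle\ge\sum_{i,j}\langle A_{ij},\dot S_i\dot S_j^{\top}\rangle$ for all $\dot S_i\in T_{S_i}$. $d_F(S,Z)=\min\{(\sum_i\|S_i-Q\|_F^2)^{1/2}:Q\in\mathbb{R}^{d\times p},QQ^{\top}=I_d\}$. $a\vee b=\max\{a,b\}$. *)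

theory Defs
  imports "HOL-Analysis.Analysis"
begin

text \<open>Conventions. The index sets {1..n}, {1..d}, {1..p} are the finite types 'n, 'd, 'p
 (n = CARD('n), d = CARD('d), p = CARD('p)). An nd x nd matrix is indexed by pairs (i,a),
 i block index, a index within the block. An nd x p matrix S is given by its d x p blocks S i.\<close>

definition blk :: "real^('n::finite \<times> 'd::finite)^('n \<times> 'd) \<Rightarrow> 'n \<Rightarrow> 'n \<Rightarrow> real^'d^'d" where
  "blk M i j = (\<chi> a b. M $ (i,a) $ (j,b))"

definition frob_inner :: "real^'c::finite^'r::finite \<Rightarrow> real^'c^'r \<Rightarrow> real" where
  "frob_inner X Y = trace (X ** transpose Y)"

definition Amat :: "real^('n::finite \<times> 'd::finite)^('n \<times> 'd) \<Rightarrow> 'n \<Rightarrow> 'n \<Rightarrow> real^'d^'d" where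
  "Amat \<Delta> i j = mat 1 + blk \<Delta> i j"

definition Lam :: "real^('n::finite \<times> 'd::finite)^('n \<times> 'd) \<Rightarrow> ('n \<Rightarrow> real^'p::finite^'d) \<Rightarrow> 'n \<Rightarrow> real^'d^'d" where
  "Lam \<Delta> S i = (1/2) *\<^sub>R (\<Sum>j\<in>UNIV. S i ** transpose (S j) ** Amat \<Delta> j i
                                   + Amat \<Delta> i j ** S j ** transpose (S i))"

definition tangent :: "real^'p::finite^'d::finite \<Rightarrow> (real^'p^'d) set" where
  "tangent Si = {Y. Si ** transpose Y + Y ** transpose Si = 0}"

definition feasible :: "('n \<Rightarrow> real^'p::finite^'d::finite) \<Rightarrow> bool" where
  "feasible S \<longleftrightarrow> (\<forall>i. S i ** transpose (S i) = mat 1)"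

definition second_order_critical ::
  "real^('n::finite \<times> 'd::finite)^('n \<times> 'd) \<Rightarrow> ('n \<Rightarrow> real^'p^'d) \<Rightarrow> bool" where
  "second_order_critical \<Delta> S \<longleftrightarrow>
     feasible S \<and>
     (\<forall>i. (\<Sum>j\<in>UNIV. Amat \<Delta> i j ** S j) = Lam \<Delta> S i ** S i) \<and>
     (\<forall>Sd :: 'n \<Rightarrow> real^'p^'d. (\<forall>i. Sd i \<in> tangent (S i)) \<longrightarrow>
        (\<Sum>i\<in>UNIV. frob_inner (Lam \<Delta> S i) (Sd i ** transpose (Sd i)))
        \<ge> (\<Sum>i\<in>UNIV. \<Sum>j\<in>UNIV. frob_inner (Amat \<Delta> i j) (Sd i ** transpose (Sd j))))"

text \<open>d_F(S,Z): norm on real^'p^'d is the Frobenius norm.\<close>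
definition dF :: "('n::finite \<Rightarrow> real^'p::finite^'d::finite) \<Rightarrow> real" where
  "dF S = Inf {sqrt (\<Sum>i\<in>UNIV. (norm (S i - Q))\<^sup>2) | Q :: real^'p^'d. Q ** transpose Q = mat 1}"

definition op_norm :: "real^'m::finite^'m \<Rightarrow> real" where
  "op_norm M = onorm (\<lambda>x. M *v x)"

definition partial_trace :: "real^('n::finite \<times> 'd::finite)^('n \<times> 'd) \<Rightarrow> real^'n^'n" where
  "partial_trace \<Delta> = (\<chi> i j. trace (blk \<Delta> i j))"

end

theory Submission
  imports Defs
begin

text \<open>
With P_i = I - S_i^T S_i the projector onto the orthogonal complement of the row space of
S_i, every d x p matrix whose k-th row is the l-th row of P_i (and whose other rows vanish) is
tangent at S_i. Summing the second-order condition over all these directions gives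
  (p - 2d) (n^2 d - m) <= (p - d) (rho - tau) + d (m - W) + (d tau - omega),
where m = |sum_i S_i|^2, W = sum_ij |S_i S_j^T|^2, rho = <S, Delta S>, tau = sum_ij tr Delta_ij
and omega = sum_ij tr(Delta_ij) |S_i S_j^T|^2. The first-order condition gives m - W <= d |Delta|^2.
Averaging over k, some Q = S_k satisfies n eta^2 <= 2 (n^2 d - m), where
eta^2 = sum_i |S_i - Q|^2, and d_F(S, Z) <= eta. Both rho - tau and d tau - omega compare a
quadratic form (with coefficients Delta, resp. Tr_d(Delta)) at S with its value at the constant
family Q, so they are at most 2 |Delta| sqrt(nd) eta and 2 sqrt 2 |Tr_d(Delta)| sqrt(nd) eta.
The resulting quadratic inequality for eta forces eta <= delta sqrt(d/n) |Delta|.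
\<close>

section \<open>The Frobenius inner product\<close>

lemma sum_swap3:
  "(\<Sum>k\<in>A. \<Sum>l\<in>B. \<Sum>i\<in>C. f k l i) = (\<Sum>i\<in>C. \<Sum>k\<in>A. \<Sum>l\<in>B. f k l i)"
proof -
  have "(\<Sum>k\<in>A. \<Sum>l\<in>B. \<Sum>i\<in>C. f k l i) = (\<Sum>k\<in>A. \<Sum>i\<in>C. \<Sum>l\<in>B. f k l i)"
    by (rule sum.cong[OF refl], rule sum.swap)
  also have "\<dots> = (\<Sum>i\<in>C. \<Sum>k\<in>A. \<Sum>l\<in>B. f k l i)"
    by (rule sum.swap)
  finally show ?thesis .
qed

lemma sum_swap4:
  "(\<Sum>k\<in>A. \<Sum>l\<in>B. \<Sum>i\<in>C. \<Sum>j\<in>D. f k l i j) = (\<Sum>i\<in>C. \<Sum>j\<in>D. \<Sum>k\<in>A. \<Sum>l\<in>B. f k l i j)"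
proof -
  have "(\<Sum>k\<in>A. \<Sum>l\<in>B. \<Sum>i\<in>C. \<Sum>j\<in>D. f k l i j) = (\<Sum>i\<in>C. \<Sum>k\<in>A. \<Sum>l\<in>B. \<Sum>j\<in>D. f k l i j)"
    by (rule sum_swap3)
  also have "\<dots> = (\<Sum>i\<in>C. \<Sum>j\<in>D. \<Sum>k\<in>A. \<Sum>l\<in>B. f k l i j)"
    by (rule sum.cong[OF refl], rule sum_swap3)
  finally show ?thesis .
qed

lemma inner_matrix_eq_trace:
  fixes X Y :: "real^'c::finite^'r::finite"
  shows "inner X Y = trace (X ** transpose Y)"
  by (simp add: trace_def matrix_matrix_mult_def transpose_def inner_vec_def)

lemma frob_inner_eq_inner: "frob_inner X Y = inner X Y"
  by (simp add: frob_inner_def inner_matrix_eq_trace)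

lemma inner_matrix_mult_left:
  fixes A :: "real^'k::finite^'r::finite" and B :: "real^'c::finite^'k" and C :: "real^'c^'r"
  shows "inner (A ** B) C = inner A (C ** transpose B)"
  by (simp add: inner_matrix_eq_trace matrix_transpose_mul matrix_mul_assoc)

lemma inner_matrix_mult_right:
  fixes A :: "real^'k::finite^'r::finite" and B :: "real^'c::finite^'k" and C :: "real^'c^'r"
  shows "inner (A ** B) C = inner B (transpose A ** C)"
proof -
  have "inner (A ** B) C = trace (A ** (B ** transpose C))"
    by (simp add: inner_matrix_eq_trace matrix_mul_assoc)
  also have "\<dots> = trace ((B ** transpose C) ** A)"
    by (rule trace_mul_sym)
  also have "\<dots> = inner B (transpose A ** C)"
    by (simp add: inner_matrix_eq_trace matrix_transpose_mul matrix_mul_assoc)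
  finally show ?thesis .
qed

lemma matrix_add_rdistrib: "(A + B) ** C = A ** C + B ** (C :: 'a::semiring_1^'c^'k)"
  by (vector matrix_matrix_mult_def sum.distrib[symmetric] field_simps)

lemma matrix_diff_rdistrib: "(A - B) ** C = A ** C - B ** (C :: 'a::ring_1^'c^'k)"
  by (vector matrix_matrix_mult_def sum_subtractf[symmetric] field_simps)

lemma matrix_diff_ldistrib: "C ** (A - B) = C ** A - C ** (B :: 'a::ring_1^'c^'k)"
  by (vector matrix_matrix_mult_def sum_subtractf[symmetric] field_simps)

lemma matrix_sum_rdistrib: "sum f I ** C = (\<Sum>i\<in>I. f i ** (C :: 'a::semiring_1^'c^'k))"
  by (induction I rule: infinite_finite_induct) (simp_all add: matrix_add_rdistrib)

lemma transpose_add: "transpose (A + B) = transpose A + transpose (B :: 'a::semiring_1^'c^'r)"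
  by (vector transpose_def)

lemma transpose_diff: "transpose (A - B) = transpose A - transpose (B :: 'a::ring_1^'c^'r)"
  by (vector transpose_def)

lemma trace_transpose: "trace (transpose A) = trace (A :: 'a::semiring_1^'n^'n)"
  by (simp add: trace_def transpose_def)

lemma trace_diff: "trace (A - B) = trace A - trace (B :: 'a::ring_1^'n^'n)"
  by (simp add: trace_def sum_subtractf)

lemma trace_sum: "trace (sum f I) = (\<Sum>i\<in>I. trace (f i :: 'a::semiring_1^'n^'n))"
  unfolding trace_def by (simp add: sum.swap[of _ UNIV I])

lemma trace_scaleR: "trace (c *\<^sub>R A) = c * trace (A :: real^'n^'n)"
  by (simp add: trace_def sum_distrib_left)

lemma inner_gram_gram:
  fixes A :: "real^'c::finite^'r::finite" and B :: "real^'c^'s::finite"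
  shows "inner (transpose A ** A) (transpose B ** B) = (norm (A ** transpose B))\<^sup>2"
proof -
  have "inner (transpose A ** A) (transpose B ** B) = inner A ((A ** transpose B) ** B)"
    by (simp add: inner_matrix_mult_right matrix_mul_assoc)
  also have "\<dots> = inner (A ** transpose B) (A ** transpose B)"
    by (metis inner_matrix_mult_left transpose_transpose)
  finally show ?thesis by (simp add: power2_norm_eq_inner)
qed

lemma norm_mat1_sq: "(norm (mat 1 :: real^'d::finite^'d))\<^sup>2 = real CARD('d)"
  by (simp add: power2_norm_eq_inner inner_matrix_eq_trace trace_I)

lemma inner_mat1: "inner A (mat 1) = trace (A :: real^'d::finite^'d)"
  by (simp add: inner_matrix_eq_trace)

section \<open>Matrices with orthonormal rows\<close>

definition orth_proj :: "real^'p::finite^'d::finite \<Rightarrow> real^'p^'p" where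
  "orth_proj S = mat 1 - transpose S ** S"

lemma transpose_orth_proj: "transpose (orth_proj S) = orth_proj S"
  by (simp add: orth_proj_def transpose_diff matrix_transpose_mul)

context
  fixes S :: "real^'p::finite^'d::finite"
  assumes orthonormal: "S ** transpose S = mat 1"
begin

lemma norm_orthonormal_sq: "(norm S)\<^sup>2 = real CARD('d)"
  by (simp add: power2_norm_eq_inner inner_matrix_eq_trace orthonormal trace_I)

lemma norm_gram_orthonormal_sq: "(norm (transpose S ** S))\<^sup>2 = real CARD('d)"
  by (simp add: power2_norm_eq_inner inner_gram_gram orthonormal inner_mat1 trace_I)

lemma trace_gram_orthonormal: "trace (transpose S ** S) = real CARD('d)"
  by (simp add: trace_mul_sym[of "transpose S"] orthonormal trace_I)

lemma mult_orth_proj: "S ** orth_proj S = 0"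
  by (simp add: orth_proj_def matrix_diff_ldistrib matrix_mul_assoc orthonormal)

lemma orth_proj_idem: "orth_proj S ** orth_proj S = orth_proj S"
proof -
  have "(transpose S ** S) ** (transpose S ** S) = transpose S ** S"
    by (metis orthonormal matrix_mul_assoc matrix_mul_rid)
  then show ?thesis
    by (simp add: orth_proj_def matrix_diff_ldistrib matrix_diff_rdistrib)
qed

lemma norm_sq_split_orth_proj:
  "(norm Y)\<^sup>2 = (norm (Y ** orth_proj S))\<^sup>2 + (norm (Y ** transpose S))\<^sup>2"
proof -
  have "(norm (Y ** orth_proj S))\<^sup>2 = inner Y (Y ** orth_proj S)"
    by (simp add: power2_norm_eq_inner inner_matrix_mult_left transpose_orth_proj
        orth_proj_idem flip: matrix_mul_assoc)
  moreover have "(norm (Y ** transpose S))\<^sup>2 = inner Y (Y ** (transpose S ** S))"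
    by (simp add: power2_norm_eq_inner inner_matrix_mult_left matrix_mul_assoc)
  ultimately show ?thesis
    by (simp add: power2_norm_eq_inner orth_proj_def matrix_diff_ldistrib inner_diff_right)
qed

lemma norm_mult_orth_proj_le: "norm (Y ** orth_proj S) \<le> norm Y"
  using norm_sq_split_orth_proj[of Y] by (simp add: power2_le_imp_le)

end

lemma inner_orth_proj:
  fixes S S' :: "real^'p::finite^'d::finite"
  assumes "S ** transpose S = mat 1" "S' ** transpose S' = mat 1"
  shows "inner (orth_proj S) (orth_proj S')
       = real CARD('p) - 2 * real CARD('d) + (norm (S ** transpose S'))\<^sup>2"
  by (simp add: orth_proj_def inner_diff_left inner_diff_right inner_mat1 trace_I trace_diff
      inner_commute[of "mat 1"] trace_gram_orthonormal assms inner_gram_gram)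

lemma norm_diff_orthonormal_sq:
  fixes S S' :: "real^'p::finite^'d::finite"
  assumes "S ** transpose S = mat 1" "S' ** transpose S' = mat 1"
  shows "(norm (S - S'))\<^sup>2 = 2 * real CARD('d) - 2 * inner S S'"
  using dot_norm_neg[of S S'] by (simp add: norm_orthonormal_sq assms)

lemma norm_gram_diff_le:
  fixes S S' :: "real^'p::finite^'d::finite"
  assumes S: "S ** transpose S = mat 1" and S': "S' ** transpose S' = mat 1"
  shows "(norm (transpose S ** S - transpose S' ** S'))\<^sup>2 \<le> 2 * (norm (S - S'))\<^sup>2"
proof -
  define C where "C = S ** transpose S'"
  have "0 \<le> (norm (C - mat 1))\<^sup>2" by simp
  also have "\<dots> = (norm C)\<^sup>2 - 2 * inner S S' + real CARD('d)"
    using dot_norm_neg[of C "mat 1"]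
    by (simp add: C_def inner_mat1 norm_mat1_sq inner_matrix_eq_trace)
  finally have "0 \<le> (norm C)\<^sup>2 - 2 * inner S S' + real CARD('d)" .
  moreover have "(norm (transpose S ** S - transpose S' ** S'))\<^sup>2 = 2 * real CARD('d) - 2 * (norm C)\<^sup>2"
    using dot_norm_neg[of "transpose S ** S" "transpose S' ** S'"]
    by (simp add: norm_gram_orthonormal_sq S S' inner_gram_gram C_def)
  ultimately show ?thesis
    using norm_diff_orthonormal_sq[OF S S'] by linarith
qed

section \<open>Quadratic forms and the operator norm\<close>

definition matrix_form :: "real^'m::finite^'m \<Rightarrow> ('m \<Rightarrow> 'v::real_inner) \<Rightarrow> ('m \<Rightarrow> 'v) \<Rightarrow> real" where
  "matrix_form K U V = (\<Sum>i\<in>UNIV. \<Sum>j\<in>UNIV. K$i$j * inner (U i) (V j))"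

lemma matrix_form_le:
  fixes K :: "real^'m::finite^'m" and U V :: "'m \<Rightarrow> 'v::euclidean_space"
  shows "matrix_form K U V
    \<le> onorm ((*v) K) * L2_set (\<lambda>i. norm (U i)) UNIV * L2_set (\<lambda>j. norm (V j)) UNIV"
proof -
  define u where "u b = (\<chi> i. inner (U i) b)" for b
  define v where "v b = (\<chi> j. inner (V j) b)" for b
  have norm_sq_coords: "(norm w)\<^sup>2 = (\<Sum>b\<in>Basis. (inner w b)\<^sup>2)" for w :: 'v
    by (simp only: power2_norm_eq_inner) (simp add: euclidean_inner[of w w] power2_eq_square)
  have L2_coords: "L2_set (\<lambda>b. norm (\<chi> i. inner (W i) b)) Basis = L2_set (\<lambda>i. norm (W i)) UNIV"
    for W :: "'m \<Rightarrow> 'v"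
    by (simp add: L2_set_def norm_vec_def sum_nonneg norm_sq_coords sum.swap[of _ Basis])
  have "matrix_form K U V = (\<Sum>b\<in>Basis. inner (u b) (K *v v b))"
    by (simp add: matrix_form_def u_def v_def euclidean_inner[of "U _" "V _"] inner_vec_def
        matrix_vector_mult_def sum_distrib_left sum.swap[of _ Basis] mult_ac)
  also have "\<dots> \<le> (\<Sum>b\<in>Basis. onorm ((*v) K) * (\<bar>norm (u b)\<bar> * \<bar>norm (v b)\<bar>))"
  proof (rule sum_mono)
    fix b :: 'v
    have "inner (u b) (K *v v b) \<le> norm (u b) * norm (K *v v b)"
      by (rule norm_cauchy_schwarz)
    also have "\<dots> \<le> norm (u b) * (onorm ((*v) K) * norm (v b))"
      by (simp add: mult_left_mono onorm)
    finally show "inner (u b) (K *v v b) \<le> onorm ((*v) K) * (\<bar>norm (u b)\<bar> * \<bar>norm (v b)\<bar>)"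
      by (simp add: mult_ac)
  qed
  also have "\<dots> \<le> onorm ((*v) K) * (L2_set (\<lambda>b. norm (u b)) Basis * L2_set (\<lambda>b. norm (v b)) Basis)"
    unfolding sum_distrib_left[symmetric]
    by (rule mult_left_mono[OF L2_set_mult_ineq onorm_pos_le[OF matrix_vector_mul_bounded_linear]])
  finally show ?thesis
    by (simp add: u_def v_def L2_coords mult_ac)
qed

lemma matrix_form_neg_left: "matrix_form K (\<lambda>i. - U i) V = - matrix_form K U V"
  by (simp add: matrix_form_def sum_negf)

lemma matrix_form_diff_left:
  "matrix_form K (\<lambda>i. U i - U' i) V = matrix_form K U V - matrix_form K U' V"
  by (simp add: matrix_form_def inner_diff_left right_diff_distrib sum_subtractf)

lemma matrix_form_diff_right:
  "matrix_form K U (\<lambda>j. V j - V' j) = matrix_form K U V - matrix_form K U V'"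
  by (simp add: matrix_form_def inner_diff_right right_diff_distrib sum_subtractf)

lemma abs_matrix_form_le:
  fixes K :: "real^'m::finite^'m" and U V :: "'m \<Rightarrow> 'v::euclidean_space"
  shows "\<bar>matrix_form K U V\<bar>
    \<le> onorm ((*v) K) * L2_set (\<lambda>i. norm (U i)) UNIV * L2_set (\<lambda>j. norm (V j)) UNIV"
  using matrix_form_le[of K U V] matrix_form_le[of K "\<lambda>i. - U i" V]
  by (simp add: matrix_form_neg_left)

lemma abs_matrix_form_diff_le:
  fixes K :: "real^'m::finite^'m" and U V :: "'m \<Rightarrow> 'v::euclidean_space"
  shows "\<bar>matrix_form K U U - matrix_form K V V\<bar>
    \<le> onorm ((*v) K) * (L2_set (\<lambda>i. norm (U i)) UNIV + L2_set (\<lambda>i. norm (V i)) UNIV)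
        * L2_set (\<lambda>i. norm (U i - V i)) UNIV"
proof -
  have "matrix_form K U U - matrix_form K V V
      = matrix_form K (\<lambda>i. U i - V i) U + matrix_form K V (\<lambda>i. U i - V i)"
    by (simp add: matrix_form_diff_left matrix_form_diff_right)
  then show ?thesis
    using abs_matrix_form_le[of K "\<lambda>i. U i - V i" U] abs_matrix_form_le[of K V "\<lambda>i. U i - V i"]
    by (simp add: algebra_simps)
qed

definition block_form ::
  "real^('n::finite \<times> 'd::finite)^('n \<times> 'd) \<Rightarrow> ('n \<Rightarrow> real^'p::finite^'d) \<Rightarrow> ('n \<Rightarrow> real^'p^'d) \<Rightarrow> real"
  where "block_form \<Delta> U V = (\<Sum>i\<in>UNIV. \<Sum>j\<in>UNIV. inner (U i) (blk \<Delta> i j ** V j))"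

lemma sum_UNIV_prod:
  "(\<Sum>x\<in>UNIV. f x) = (\<Sum>i\<in>UNIV. \<Sum>a\<in>UNIV. f (i, a) :: 'c::comm_monoid_add)"
  by (simp add: sum.cartesian_product flip: UNIV_Times_UNIV)

lemma block_form_eq_matrix_form:
  "block_form \<Delta> U V = matrix_form \<Delta> (\<lambda>x. U (fst x) $ snd x) (\<lambda>y. V (fst y) $ snd y)"
proof -
  have entry: "inner (U i) (blk \<Delta> i j ** V j)
      = (\<Sum>a\<in>UNIV. \<Sum>b\<in>UNIV. \<Delta>$(i,a)$(j,b) * inner (U i $ a) (V j $ b))" for i j
    by (simp add: inner_vec_def blk_def matrix_matrix_mult_def sum_distrib_left mult_ac)
      (rule sum.cong[OF refl], rule sum.swap)
  show ?thesis
    by (simp add: block_form_def matrix_form_def entry sum_UNIV_prod)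
      (rule sum.cong[OF refl], rule sum.swap)
qed

lemma L2_set_flatten:
  "L2_set (\<lambda>x. norm (U (fst x) $ snd x)) UNIV = L2_set (\<lambda>i. norm (U i :: real^'c::finite^'r::finite)) UNIV"
  by (simp add: L2_set_def sum_UNIV_prod norm_vec_def sum_nonneg)

lemma op_norm_nonneg: "0 \<le> op_norm M"
  by (simp add: op_norm_def onorm_pos_le)

lemma abs_block_form_le:
  "\<bar>block_form \<Delta> U V\<bar> \<le> op_norm \<Delta> * L2_set (\<lambda>i. norm (U i)) UNIV * L2_set (\<lambda>j. norm (V j)) UNIV"
  using abs_matrix_form_le[of \<Delta> "\<lambda>x. U (fst x) $ snd x" "\<lambda>y. V (fst y) $ snd y"]
  by (simp add: block_form_eq_matrix_form op_norm_def L2_set_flatten)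

lemma abs_block_form_diff_le:
  "\<bar>block_form \<Delta> U U - block_form \<Delta> V V\<bar>
    \<le> op_norm \<Delta> * (L2_set (\<lambda>i. norm (U i)) UNIV + L2_set (\<lambda>i. norm (V i)) UNIV)
        * L2_set (\<lambda>i. norm (U i - V i)) UNIV"
  using abs_matrix_form_diff_le[of \<Delta> "\<lambda>x. U (fst x) $ snd x" "\<lambda>y. V (fst y) $ snd y"]
  by (simp add: block_form_eq_matrix_form op_norm_def L2_set_flatten
      L2_set_flatten[of "\<lambda>i. U i - V i", simplified])

lemma L2_set_block_mult_le:
  "L2_set (\<lambda>i. norm (\<Sum>j\<in>UNIV. blk \<Delta> i j ** V j)) UNIV \<le> op_norm \<Delta> * L2_set (\<lambda>j. norm (V j)) UNIV"
proof -
  define R where "R i = (\<Sum>j\<in>UNIV. blk \<Delta> i j ** V j)" for i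
  define r where "r = L2_set (\<lambda>i. norm (R i)) UNIV"
  have "r * r = (\<Sum>i\<in>UNIV. (norm (R i))\<^sup>2)"
    by (simp add: r_def L2_set_def sum_nonneg flip: power2_eq_square)
  also have "\<dots> = block_form \<Delta> R V"
    by (simp add: block_form_def R_def power2_norm_eq_inner inner_sum_right)
  also have "\<dots> \<le> r * (op_norm \<Delta> * L2_set (\<lambda>j. norm (V j)) UNIV)"
    using abs_block_form_le[of \<Delta> R V] by (simp add: r_def mult_ac)
  finally have "r * r \<le> r * (op_norm \<Delta> * L2_set (\<lambda>j. norm (V j)) UNIV)" .
  moreover have "0 \<le> op_norm \<Delta> * L2_set (\<lambda>j. norm (V j)) UNIV"
    by (simp add: op_norm_nonneg L2_set_nonneg)
  ultimately show ?thesis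
    unfolding R_def[symmetric] r_def[symmetric]
    by (cases "r = 0") (simp_all add: r_def L2_set_nonneg order_le_neq_trans)
qed

section \<open>The second-order condition along projected directions\<close>

lemma inner_axis_mult_transpose_axis:
  fixes B :: "real^'d::finite^'d" and v w :: "real^'p::finite"
  shows "inner B (axis k v ** transpose (axis k w)) = B$k$k * inner v w"
proof -
  have "axis k v ** transpose (axis k w) = axis k (axis k (inner v w))"
    by (simp add: vec_eq_iff axis_def matrix_matrix_mult_def transpose_def inner_vec_def)
  then show ?thesis by (simp add: inner_axis inner_axis')
qed

lemma sum_inner_axis_rows:
  fixes B :: "real^'d::finite^'d" and F H :: "real^'p::finite^'q::finite"
  shows "(\<Sum>k\<in>UNIV. \<Sum>l\<in>UNIV. inner B (axis k (F$l) ** transpose (axis k (H$l)))) = trace B * inner F H"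
  by (simp add: inner_axis_mult_transpose_axis trace_def inner_vec_def[of F] sum_distrib_left
      sum_distrib_right) (rule sum.swap)

lemma axis_row_in_tangent:
  fixes S :: "real^'p::finite^'d::finite" and P :: "real^'p^'p"
  assumes SP: "S ** P = 0" and P: "transpose P = P"
  shows "axis k (P$l) \<in> tangent S"
proof -
  have "(S ** transpose (axis k (P$l)))$a$b = (if b = k then (S ** P)$a$l else 0)" for a b
    using arg_cong[OF P, of "\<lambda>X. X$l"]
    by (simp add: matrix_matrix_mult_def transpose_def axis_def vec_eq_iff)
  then have "S ** transpose (axis k (P$l)) = 0"
    by (simp add: vec_eq_iff SP)
  moreover from this have "axis k (P$l) ** transpose S = 0"
    by (metis matrix_transpose_mul transpose_transpose times0_left transpose_mat mat_0)
  ultimately show ?thesis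
    by (simp add: tangent_def)
qed

lemma second_order_orth_proj_inequality:
  fixes \<Delta> :: "real^('n::finite \<times> 'd::finite)^('n \<times> 'd)" and S :: "'n \<Rightarrow> real^'p::finite^'d"
  assumes soc: "second_order_critical \<Delta> S"
  shows "(\<Sum>i\<in>UNIV. \<Sum>j\<in>UNIV. trace (Amat \<Delta> i j) * inner (orth_proj (S i)) (orth_proj (S j)))
     \<le> (real CARD('p) - real CARD('d)) * (\<Sum>i\<in>UNIV. trace (Lam \<Delta> S i))"
proof -
  have S: "S i ** transpose (S i) = mat 1" for i
    using soc by (simp add: second_order_critical_def feasible_def)
  define Y :: "'d \<Rightarrow> 'p \<Rightarrow> 'n \<Rightarrow> real^'p^'d" where "Y k l i = axis k (orth_proj (S i) $ l)" for k l i
  have test: "(\<Sum>i\<in>UNIV. \<Sum>j\<in>UNIV. inner (Amat \<Delta> i j) (Y k l i ** transpose (Y k l j)))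
      \<le> (\<Sum>i\<in>UNIV. inner (Lam \<Delta> S i) (Y k l i ** transpose (Y k l i)))" for k l
  proof -
    have "Y k l i \<in> tangent (S i)" for i
      unfolding Y_def by (rule axis_row_in_tangent[OF mult_orth_proj[OF S] transpose_orth_proj])
    then show ?thesis
      using soc by (simp add: second_order_critical_def frob_inner_eq_inner)
  qed
  have "(\<Sum>i\<in>UNIV. \<Sum>j\<in>UNIV. trace (Amat \<Delta> i j) * inner (orth_proj (S i)) (orth_proj (S j)))
      = (\<Sum>k\<in>UNIV. \<Sum>l\<in>UNIV. \<Sum>i\<in>UNIV. \<Sum>j\<in>UNIV. inner (Amat \<Delta> i j) (Y k l i ** transpose (Y k l j)))"
    by (simp add: Y_def sum_swap4 sum_inner_axis_rows)
  also have "\<dots> \<le> (\<Sum>k\<in>UNIV. \<Sum>l\<in>UNIV. \<Sum>i\<in>UNIV. inner (Lam \<Delta> S i) (Y k l i ** transpose (Y k l i)))"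
    by (intro sum_mono test)
  also have "\<dots> = (\<Sum>i\<in>UNIV. trace (Lam \<Delta> S i) * inner (orth_proj (S i)) (orth_proj (S i)))"
    by (simp add: Y_def sum_swap3 sum_inner_axis_rows)
  also have "\<dots> = (real CARD('p) - real CARD('d)) * (\<Sum>i\<in>UNIV. trace (Lam \<Delta> S i))"
    by (simp add: inner_orth_proj S norm_mat1_sq sum_distrib_left mult.commute)
  finally show ?thesis .
qed

lemma blk_transpose: "transpose \<Delta> = \<Delta> \<Longrightarrow> transpose (blk \<Delta> j i) = blk \<Delta> i j"
  by (metis (no_types, lifting) blk_def transpose_def vec_lambda_beta vec_lambda_unique)

lemma sum_trace_Lam:
  fixes \<Delta> :: "real^('n::finite \<times> 'd::finite)^('n \<times> 'd)" and S :: "'n \<Rightarrow> real^'p::finite^'d"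
  assumes sym: "transpose \<Delta> = \<Delta>"
  shows "(\<Sum>i\<in>UNIV. trace (Lam \<Delta> S i)) = (norm (\<Sum>i\<in>UNIV. S i))\<^sup>2 + block_form \<Delta> S S"
proof -
  have "trace (S i ** transpose (S j) ** Amat \<Delta> j i) = trace (Amat \<Delta> i j ** S j ** transpose (S i))" for i j
  proof -
    have "trace (S i ** transpose (S j) ** Amat \<Delta> j i) = trace (transpose (S i ** transpose (S j) ** Amat \<Delta> j i))"
      by (simp add: trace_transpose)
    then show ?thesis
      by (simp add: matrix_transpose_mul Amat_def transpose_add blk_transpose[OF sym] matrix_mul_assoc)
  qed
  moreover have "trace (Amat \<Delta> i j ** S j ** transpose (S i)) = inner (S i) (S j) + inner (S i) (blk \<Delta> i j ** S j)" for i j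
    by (simp add: Amat_def matrix_add_rdistrib trace_add inner_commute[of "S i"] flip: inner_matrix_eq_trace)
  ultimately have "trace (Lam \<Delta> S i) = (\<Sum>j\<in>UNIV. inner (S i) (S j) + inner (S i) (blk \<Delta> i j ** S j))"
    for i by (simp add: Lam_def trace_scaleR trace_sum trace_add sum.distrib)
  moreover have "(norm (\<Sum>i\<in>UNIV. S i))\<^sup>2 = (\<Sum>i\<in>UNIV. \<Sum>j\<in>UNIV. inner (S i) (S j))"
    by (simp add: power2_norm_eq_inner inner_sum_left inner_sum_right) (rule sum.swap)
  ultimately show ?thesis
    by (simp add: sum.distrib block_form_def)
qed

section \<open>The first-order condition and the choice of a centre\<close>

lemma norm_sum_sq_le_card:
  fixes f :: "'n::finite \<Rightarrow> 'a::real_normed_vector"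
  shows "(norm (\<Sum>j\<in>UNIV. f j))\<^sup>2 \<le> real CARD('n) * (\<Sum>j\<in>UNIV. (norm (f j))\<^sup>2)"
proof -
  have "norm (\<Sum>j\<in>UNIV. f j) \<le> (\<Sum>j\<in>UNIV. \<bar>norm (f j)\<bar> * \<bar>1\<bar>)"
    using norm_sum[of f UNIV] by simp
  also have "\<dots> \<le> L2_set (\<lambda>j. norm (f j)) UNIV * L2_set (\<lambda>j::'n. 1) UNIV"
    by (rule L2_set_mult_ineq)
  finally have "(norm (\<Sum>j\<in>UNIV. f j))\<^sup>2 \<le> (L2_set (\<lambda>j. norm (f j)) UNIV * sqrt (real CARD('n)))\<^sup>2"
    by (simp add: L2_set_constant power_mono)
  then show ?thesis
    by (simp add: L2_set_def power_mult_distrib sum_nonneg mult.commute)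
qed

lemma L2_set_orthonormal:
  assumes "\<And>i. S i ** transpose (S i) = (mat 1 :: real^'d::finite^'d)"
  shows "L2_set (\<lambda>i. norm (S i :: real^'p::finite^'d)) (UNIV :: 'n::finite set)
    = sqrt (real CARD('n) * real CARD('d))"
  by (simp add: L2_set_def norm_orthonormal_sq assms)

lemma sum_norm_gram_lower_bound:
  fixes S :: "'n::finite \<Rightarrow> real^'p::finite^'d::finite"
  assumes S: "\<And>i. S i ** transpose (S i) = mat 1"
  shows "(norm (\<Sum>i\<in>UNIV. S i))\<^sup>2 - (\<Sum>i\<in>UNIV. (norm ((\<Sum>j\<in>UNIV. S j) ** orth_proj (S i)))\<^sup>2) / real CARD('n)
    \<le> (\<Sum>i\<in>UNIV. \<Sum>j\<in>UNIV. (norm (S i ** transpose (S j)))\<^sup>2)"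
proof -
  define M where "M = (\<Sum>i\<in>UNIV. S i)"
  have row: "(norm M)\<^sup>2 - (norm (M ** orth_proj (S i)))\<^sup>2
      \<le> real CARD('n) * (\<Sum>j\<in>UNIV. (norm (S j ** transpose (S i)))\<^sup>2)" for i
  proof -
    have "(norm M)\<^sup>2 - (norm (M ** orth_proj (S i)))\<^sup>2 = (norm (\<Sum>j\<in>UNIV. S j ** transpose (S i)))\<^sup>2"
      using norm_sq_split_orth_proj[OF S[of i], of M] by (simp add: M_def matrix_sum_rdistrib)
    then show ?thesis
      using norm_sum_sq_le_card[of "\<lambda>j. S j ** transpose (S i)"] by simp
  qed
  have "(\<Sum>i\<in>UNIV. (norm M)\<^sup>2 - (norm (M ** orth_proj (S i)))\<^sup>2)
      \<le> (\<Sum>i\<in>UNIV. real CARD('n) * (\<Sum>j\<in>UNIV. (norm (S j ** transpose (S i)))\<^sup>2))"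
    by (rule sum_mono[OF row])
  also have "\<dots> = real CARD('n) * (\<Sum>i\<in>UNIV. \<Sum>j\<in>UNIV. (norm (S i ** transpose (S j)))\<^sup>2)"
    by (simp add: sum_distrib_left) (rule sum.swap)
  finally show ?thesis
    by (simp add: M_def sum_subtractf field_simps)
qed

lemma gram_deficit_le:
  fixes \<Delta> :: "real^('n::finite \<times> 'd::finite)^('n \<times> 'd)" and S :: "'n \<Rightarrow> real^'p::finite^'d"
  assumes soc: "second_order_critical \<Delta> S"
  shows "(norm (\<Sum>i\<in>UNIV. S i))\<^sup>2 - (\<Sum>i\<in>UNIV. \<Sum>j\<in>UNIV. (norm (S i ** transpose (S j)))\<^sup>2)
    \<le> real CARD('d) * (op_norm \<Delta>)\<^sup>2"
proof -
  have S: "S i ** transpose (S i) = mat 1" for i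
    using soc by (simp add: second_order_critical_def feasible_def)
  define M where "M = (\<Sum>j\<in>UNIV. S j)"
  define R where "R i = (\<Sum>j\<in>UNIV. blk \<Delta> i j ** S j)" for i
  have first_order: "norm (M ** orth_proj (S i)) \<le> norm (R i)" for i
  proof -
    have "M + R i = Lam \<Delta> S i ** S i"
      using soc by (simp add: second_order_critical_def M_def R_def Amat_def matrix_add_rdistrib
          sum.distrib)
    then have "M ** orth_proj (S i) = - (R i ** orth_proj (S i))"
      by (metis add_eq_0_iff2 matrix_add_rdistrib matrix_mul_assoc mult_orth_proj[OF S] times0_right)
    then show ?thesis
      using norm_mult_orth_proj_le[OF S] by simp
  qed
  have "(\<Sum>i\<in>UNIV. (norm (M ** orth_proj (S i)))\<^sup>2) \<le> (\<Sum>i\<in>UNIV. (norm (R i))\<^sup>2)"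
    by (intro sum_mono power_mono first_order norm_ge_zero)
  also have "\<dots> = (L2_set (\<lambda>i. norm (R i)) UNIV)\<^sup>2"
    by (simp add: L2_set_def sum_nonneg)
  also have "\<dots> \<le> (op_norm \<Delta> * L2_set (\<lambda>j. norm (S j)) UNIV)\<^sup>2"
    unfolding R_def by (intro power_mono L2_set_block_mult_le L2_set_nonneg)
  also have "\<dots> = real CARD('n) * (real CARD('d) * (op_norm \<Delta>)\<^sup>2)"
    by (simp add: L2_set_orthonormal[OF S] power_mult_distrib)
  finally have "(\<Sum>i\<in>UNIV. (norm (M ** orth_proj (S i)))\<^sup>2) / real CARD('n) \<le> real CARD('d) * (op_norm \<Delta>)\<^sup>2"
    by (simp add: pos_divide_le_eq mult.commute)
  then show ?thesis
    using sum_norm_gram_lower_bound[of S, OF S] unfolding M_def by linarith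
qed

lemma exists_center:
  fixes S :: "'n::finite \<Rightarrow> real^'p::finite^'d::finite"
  assumes S: "\<And>i. S i ** transpose (S i) = mat 1"
  obtains k where "real CARD('n) * (L2_set (\<lambda>i. norm (S i - S k)) UNIV)\<^sup>2
    \<le> 2 * ((real CARD('n))\<^sup>2 * real CARD('d) - (norm (\<Sum>i\<in>UNIV. S i))\<^sup>2)"
proof -
  define f where "f k = (\<Sum>i\<in>UNIV. (norm (S i - S k))\<^sup>2)" for k
  have "Min (range f) \<in> range f"
    by (rule Min_in) simp_all
  then obtain k where k: "f k = Min (range f)"
    by (metis rangeE)
  have "real CARD('n) * f k \<le> sum f UNIV"
    using sum_bounded_below[of UNIV "f k" f] by (simp add: k)
  also have "\<dots> = (\<Sum>k\<in>UNIV. \<Sum>i\<in>UNIV. 2 * real CARD('d) - 2 * inner (S i) (S k))"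
    by (simp add: f_def norm_diff_orthonormal_sq S)
  also have "\<dots> = 2 * ((real CARD('n))\<^sup>2 * real CARD('d) - (\<Sum>k\<in>UNIV. \<Sum>i\<in>UNIV. inner (S i) (S k)))"
    by (simp add: sum_subtractf sum_distrib_left power2_eq_square algebra_simps)
  also have "(\<Sum>k\<in>UNIV. \<Sum>i\<in>UNIV. inner (S i) (S k)) = (norm (\<Sum>i\<in>UNIV. S i))\<^sup>2"
    by (simp add: power2_norm_eq_inner inner_sum_left inner_sum_right)
  finally show ?thesis
    using that by (simp add: f_def L2_set_def sum_nonneg)
qed

lemma dF_le_L2_set:
  assumes "Q ** transpose Q = mat 1"
  shows "dF S \<le> L2_set (\<lambda>i. norm (S i - Q)) UNIV"
  unfolding dF_def L2_set_def
  by (rule cInf_lower) (use assms in \<open>auto intro!: bdd_belowI[of _ 0] simp: sum_nonneg\<close>)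

section \<open>Deviation from a constant family\<close>

lemma block_form_const_orthonormal:
  assumes "Q ** transpose Q = mat 1"
  shows "block_form \<Delta> (\<lambda>_. Q) (\<lambda>_. Q) = (\<Sum>i\<in>UNIV. \<Sum>j\<in>UNIV. trace (blk \<Delta> i j))"
  by (simp add: block_form_def inner_commute[of Q] inner_matrix_mult_left assms inner_mat1)

lemma abs_block_form_deviation_le:
  fixes S :: "'n::finite \<Rightarrow> real^'p::finite^'d::finite"
  assumes S: "\<And>i. S i ** transpose (S i) = mat 1" and Q: "Q ** transpose Q = mat 1"
  shows "\<bar>block_form \<Delta> S S - (\<Sum>i\<in>UNIV. \<Sum>j\<in>UNIV. trace (blk \<Delta> i j))\<bar>
    \<le> 2 * op_norm \<Delta> * sqrt (real CARD('n) * real CARD('d)) * L2_set (\<lambda>i. norm (S i - Q)) UNIV"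
  using abs_block_form_diff_le[of \<Delta> S "\<lambda>_. Q"]
  by (simp add: block_form_const_orthonormal[OF Q] L2_set_orthonormal[OF S]
      L2_set_orthonormal[of "\<lambda>_. Q", OF Q])

lemma abs_gram_form_deviation_le:
  fixes S :: "'n::finite \<Rightarrow> real^'p::finite^'d::finite"
  assumes S: "\<And>i. S i ** transpose (S i) = mat 1" and Q: "Q ** transpose Q = mat 1"
  shows "\<bar>(\<Sum>i\<in>UNIV. \<Sum>j\<in>UNIV. trace (blk \<Delta> i j) * (norm (S i ** transpose (S j)))\<^sup>2)
      - real CARD('d) * (\<Sum>i\<in>UNIV. \<Sum>j\<in>UNIV. trace (blk \<Delta> i j))\<bar>
    \<le> 2 * sqrt 2 * op_norm (partial_trace \<Delta>) * sqrt (real CARD('n) * real CARD('d))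
      * L2_set (\<lambda>i. norm (S i - Q)) UNIV"
proof -
  define G where "G i = transpose (S i) ** S i" for i
  define G\<^sub>Q where "G\<^sub>Q = transpose Q ** Q"
  have norm_G: "(norm (G i))\<^sup>2 = real CARD('d)" "(norm G\<^sub>Q)\<^sup>2 = real CARD('d)" for i
    unfolding G_def G\<^sub>Q_def by (simp_all add: norm_gram_orthonormal_sq S Q)
  have "norm (G i - G\<^sub>Q) \<le> sqrt (2 * (norm (S i - Q))\<^sup>2)" for i
    unfolding G_def G\<^sub>Q_def by (rule real_le_rsqrt, rule norm_gram_diff_le[OF S Q])
  then have "norm (G i - G\<^sub>Q) \<le> sqrt 2 * norm (S i - Q)" for i
    by (simp add: real_sqrt_mult)
  then have L2_diff: "L2_set (\<lambda>i. norm (G i - G\<^sub>Q)) UNIV \<le> sqrt 2 * L2_set (\<lambda>i. norm (S i - Q)) UNIV"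
    by (simp add: L2_set_right_distrib L2_set_mono)
  have L2_G: "L2_set (\<lambda>i. norm (G i)) UNIV = sqrt (real CARD('n) * real CARD('d))"
    "L2_set (\<lambda>i::'n. norm G\<^sub>Q) UNIV = sqrt (real CARD('n) * real CARD('d))"
    by (simp_all add: L2_set_def norm_G)
  have "matrix_form (partial_trace \<Delta>) G G
      = (\<Sum>i\<in>UNIV. \<Sum>j\<in>UNIV. trace (blk \<Delta> i j) * (norm (S i ** transpose (S j)))\<^sup>2)"
    by (simp add: matrix_form_def partial_trace_def G_def inner_gram_gram)
  moreover have "matrix_form (partial_trace \<Delta>) (\<lambda>_. G\<^sub>Q) (\<lambda>_. G\<^sub>Q)
      = real CARD('d) * (\<Sum>i\<in>UNIV. \<Sum>j\<in>UNIV. trace (blk \<Delta> i j))"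
    by (simp add: matrix_form_def partial_trace_def norm_G sum_distrib_left mult.commute
        flip: power2_norm_eq_inner)
  ultimately have "\<bar>(\<Sum>i\<in>UNIV. \<Sum>j\<in>UNIV. trace (blk \<Delta> i j) * (norm (S i ** transpose (S j)))\<^sup>2)
      - real CARD('d) * (\<Sum>i\<in>UNIV. \<Sum>j\<in>UNIV. trace (blk \<Delta> i j))\<bar>
    \<le> op_norm (partial_trace \<Delta>) * (2 * sqrt (real CARD('n) * real CARD('d)))
      * L2_set (\<lambda>i. norm (G i - G\<^sub>Q)) UNIV"
    using abs_matrix_form_diff_le[of "partial_trace \<Delta>" G "\<lambda>_. G\<^sub>Q"] by (simp add: L2_G op_norm_def)
  also have "\<dots> \<le> op_norm (partial_trace \<Delta>) * (2 * sqrt (real CARD('n) * real CARD('d)))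
      * (sqrt 2 * L2_set (\<lambda>i. norm (S i - Q)) UNIV)"
    by (intro mult_left_mono L2_diff) (simp add: op_norm_nonneg)
  finally show ?thesis
    by (simp add: mult_ac)
qed

section \<open>The quadratic estimate\<close>

lemma second_order_estimate:
  fixes \<Delta> :: "real^('n::finite \<times> 'd::finite)^('n \<times> 'd)" and S :: "'n \<Rightarrow> real^'p::finite^'d"
  assumes sym: "transpose \<Delta> = \<Delta>" and soc: "second_order_critical \<Delta> S"
  shows "(real CARD('p) - 2 * real CARD('d))
        * ((real CARD('n))\<^sup>2 * real CARD('d) + (\<Sum>i\<in>UNIV. \<Sum>j\<in>UNIV. trace (blk \<Delta> i j)))
      + real CARD('d) * (\<Sum>i\<in>UNIV. \<Sum>j\<in>UNIV. (norm (S i ** transpose (S j)))\<^sup>2)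
      + (\<Sum>i\<in>UNIV. \<Sum>j\<in>UNIV. trace (blk \<Delta> i j) * (norm (S i ** transpose (S j)))\<^sup>2)
    \<le> (real CARD('p) - real CARD('d)) * ((norm (\<Sum>i\<in>UNIV. S i))\<^sup>2 + block_form \<Delta> S S)"
proof -
  have S: "S i ** transpose (S i) = mat 1" for i
    using soc by (simp add: second_order_critical_def feasible_def)
  define T where "T i j = trace (blk \<Delta> i j)" for i j
  define w where "w i j = (norm (S i ** transpose (S j)))\<^sup>2" for i j
  define c where "c = real CARD('p) - 2 * real CARD('d)"
  have entry: "trace (Amat \<Delta> i j) * inner (orth_proj (S i)) (orth_proj (S j))
      = c * real CARD('d) + c * T i j + real CARD('d) * w i j + T i j * w i j" for i j
    by (simp add: Amat_def trace_add trace_I inner_orth_proj S T_def w_def c_def algebra_simps)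
  have "c * ((real CARD('n))\<^sup>2 * real CARD('d) + (\<Sum>i\<in>UNIV. \<Sum>j\<in>UNIV. T i j))
      + real CARD('d) * (\<Sum>i\<in>UNIV. \<Sum>j\<in>UNIV. w i j) + (\<Sum>i\<in>UNIV. \<Sum>j\<in>UNIV. T i j * w i j)
      = (\<Sum>i\<in>UNIV. \<Sum>j\<in>UNIV. trace (Amat \<Delta> i j) * inner (orth_proj (S i)) (orth_proj (S j)))"
    by (simp add: entry sum.distrib sum_distrib_left power2_eq_square algebra_simps)
  also have "\<dots> \<le> (real CARD('p) - real CARD('d)) * (\<Sum>i\<in>UNIV. trace (Lam \<Delta> S i))"
    by (rule second_order_orth_proj_inequality[OF soc])
  also have "\<dots> = (real CARD('p) - real CARD('d)) * ((norm (\<Sum>i\<in>UNIV. S i))\<^sup>2 + block_form \<Delta> S S)"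
    by (simp add: sum_trace_Lam[OF sym])
  finally show ?thesis
    unfolding T_def w_def c_def .
qed

lemma quadratic_upper_root_bound:
  fixes x r :: real
  assumes r: "0 \<le> r" and quad: "x\<^sup>2 \<le> 4 * r * x + r\<^sup>2"
  shows "x \<le> (2 + sqrt 5) * r"
proof (rule ccontr)
  assume "\<not> ?thesis"
  moreover have "(2 - sqrt 5) * r \<le> (2 + sqrt 5) * r"
    using r by (intro mult_right_mono) simp_all
  ultimately have "0 < (x - (2 + sqrt 5) * r) * (x - (2 - sqrt 5) * r)"
    by simp
  also have "\<dots> = x\<^sup>2 - 4 * r * x - r\<^sup>2"
    by (simp add: algebra_simps power2_eq_square)
  finally show False
    using quad by simp
qed

lemma quadratic_estimate_normalized_imp_bound:
  fixes d p \<gamma> a t \<eta> :: real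
  assumes d: "1 \<le> d" and p: "2 * d < p" and \<gamma>: "1 \<le> \<gamma>" and a: "0 \<le> a"
    and t: "t \<le> \<gamma> * a" and \<eta>: "0 \<le> \<eta>"
    and est: "(p - 2 * d) * \<eta>\<^sup>2 \<le> 4 * (p - d) * a * \<eta> + 4 * sqrt 2 * t * \<eta> + 2 * d * a\<^sup>2"
  shows "\<eta> \<le> (2 + sqrt 5) * ((p + d) * \<gamma> * a / (p - 2 * d))"
proof -
  define q where "q = p - 2 * d"
  define c where "c = (p + d) * \<gamma>"
  have q: "0 < q"
    using p by (simp add: q_def)
  have "sqrt 2 \<le> 2"
    by (rule real_le_lsqrt) simp_all
  then have "(p + d - sqrt 2) * 1 \<le> (p + d - sqrt 2) * \<gamma>"
    using p d \<gamma> by (intro mult_left_mono) simp_all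
  then have "(p - d) + sqrt 2 * \<gamma> \<le> c"
    using \<open>sqrt 2 \<le> 2\<close> d by (simp add: c_def algebra_simps)
  then have c: "4 * ((p - d) + sqrt 2 * \<gamma>) * a * \<eta> \<le> 4 * c * a * \<eta>"
    using a \<eta> by (intro mult_right_mono mult_left_mono) simp_all
  have "4 * (p - d) * a * \<eta> + 4 * sqrt 2 * t * \<eta> \<le> 4 * (p - d) * a * \<eta> + 4 * sqrt 2 * (\<gamma> * a) * \<eta>"
    using t \<eta> by (simp add: mult_right_mono)
  also have "\<dots> = 4 * ((p - d) + sqrt 2 * \<gamma>) * a * \<eta>"
    by (simp add: algebra_simps)
  finally have "4 * (p - d) * a * \<eta> + 4 * sqrt 2 * t * \<eta> \<le> 4 * c * a * \<eta>"
    using c by linarith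
  moreover have "2 * d * a\<^sup>2 \<le> (c\<^sup>2 / q) * a\<^sup>2"
  proof -
    have "2 * d * q \<le> (p + d)\<^sup>2"
      by (simp add: q_def power2_eq_square algebra_simps)
    also have "\<dots> \<le> c\<^sup>2"
      unfolding c_def using p d \<gamma> by (intro power_mono) (simp_all add: mult_le_cancel_left1)
    finally show ?thesis
      using q by (intro mult_right_mono) (simp_all add: pos_le_divide_eq)
  qed
  ultimately have "q * \<eta>\<^sup>2 \<le> 4 * c * a * \<eta> + (c\<^sup>2 / q) * a\<^sup>2"
    using est unfolding q_def by linarith
  also have "\<dots> = q * (4 * (c * a / q) * \<eta> + (c * a / q)\<^sup>2)"
    using q by (simp add: field_simps power2_eq_square)
  finally have "\<eta>\<^sup>2 \<le> 4 * (c * a / q) * \<eta> + (c * a / q)\<^sup>2"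
    using q by simp
  then show ?thesis
    unfolding c_def q_def using q c_def \<gamma> p d a
    by (intro quadratic_upper_root_bound) (simp_all add: q_def)
qed

lemma quadratic_estimate_imp_bound:
  fixes n d p D t \<gamma> \<eta> :: real
  assumes n: "0 < n" and d: "1 \<le> d" and p: "2 * d < p" and D: "0 \<le> D"
    and \<gamma>: "1 \<le> \<gamma>" and t: "t \<le> \<gamma> * D" and \<eta>: "0 \<le> \<eta>"
    and est: "(p - 2 * d) * n * \<eta>\<^sup>2 / 2
      \<le> 2 * (p - d) * D * sqrt (n * d) * \<eta> + 2 * sqrt 2 * t * sqrt (n * d) * \<eta> + d\<^sup>2 * D\<^sup>2"
  shows "\<eta> \<le> (2 + sqrt 5) * (p + d) * \<gamma> / (p - 2 * d) * sqrt (d / n) * D"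
proof -
  define s where "s = sqrt (d / n)"
  have s: "0 \<le> s"
    using n d by (simp add: s_def)
  have "n * d = n\<^sup>2 * (d / n)"
    using n by (simp add: power2_eq_square)
  then have "sqrt (n * d) = sqrt (n\<^sup>2) * s"
    by (metis real_sqrt_mult s_def)
  then have sqrt_nd: "sqrt (n * d) = n * s"
    using n by simp
  have dD: "d\<^sup>2 * D\<^sup>2 = n * (d * (s * D)\<^sup>2)"
    using n d by (simp add: s_def power_mult_distrib power2_eq_square)
  have "n * ((p - 2 * d) * \<eta>\<^sup>2) = 2 * ((p - 2 * d) * n * \<eta>\<^sup>2 / 2)"
    by simp
  also have "\<dots> \<le> 2 * (2 * (p - d) * D * (n * s) * \<eta> + 2 * sqrt 2 * t * (n * s) * \<eta> + n * (d * (s * D)\<^sup>2))"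
    using est unfolding sqrt_nd dD by simp
  also have "\<dots> = n * (4 * (p - d) * (s * D) * \<eta> + 4 * sqrt 2 * (t * s) * \<eta> + 2 * d * (s * D)\<^sup>2)"
    by (simp add: algebra_simps)
  finally have "(p - 2 * d) * \<eta>\<^sup>2 \<le> 4 * (p - d) * (s * D) * \<eta> + 4 * sqrt 2 * (t * s) * \<eta> + 2 * d * (s * D)\<^sup>2"
    using n by simp
  moreover have "t * s \<le> \<gamma> * (s * D)"
    using mult_right_mono[OF t s] by (simp add: mult_ac)
  ultimately have "\<eta> \<le> (2 + sqrt 5) * ((p + d) * \<gamma> * (s * D) / (p - 2 * d))"
    using d p \<gamma> s D \<eta> by (intro quadratic_estimate_normalized_imp_bound) simp_all
  then show ?thesis
    by (simp add: s_def mult_ac)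
qed

lemma distance_quadratic_estimate:
  fixes \<Delta> :: "real^('n::finite \<times> 'd::finite)^('n \<times> 'd)" and S :: "'n \<Rightarrow> real^'p::finite^'d"
    and Q :: "real^'p^'d"
  defines "n \<equiv> real CARD('n)" and "d \<equiv> real CARD('d)" and "p \<equiv> real CARD('p)"
    and "D \<equiv> op_norm \<Delta>" and "t \<equiv> op_norm (partial_trace \<Delta>)"
    and "\<eta> \<equiv> L2_set (\<lambda>i. norm (S i - Q)) UNIV"
  assumes p: "2 * d \<le> p" and sym: "transpose \<Delta> = \<Delta>" and soc: "second_order_critical \<Delta> S"
    and Q: "Q ** transpose Q = mat 1"
    and center: "n * \<eta>\<^sup>2 \<le> 2 * (n\<^sup>2 * d - (norm (\<Sum>i\<in>UNIV. S i))\<^sup>2)"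
  shows "(p - 2 * d) * n * \<eta>\<^sup>2 / 2
    \<le> 2 * (p - d) * D * sqrt (n * d) * \<eta> + 2 * sqrt 2 * t * sqrt (n * d) * \<eta> + d\<^sup>2 * D\<^sup>2"
proof -
  have S: "\<And>i. S i ** transpose (S i) = mat 1"
    using soc by (simp add: second_order_critical_def feasible_def)
  define m where "m = (norm (\<Sum>i\<in>UNIV. S i))\<^sup>2"
  define \<rho> where "\<rho> = block_form \<Delta> S S"
  define \<tau> where "\<tau> = (\<Sum>i\<in>UNIV. \<Sum>j\<in>UNIV. trace (blk \<Delta> i j))"
  define W where "W = (\<Sum>i\<in>UNIV. \<Sum>j\<in>UNIV. (norm (S i ** transpose (S j)))\<^sup>2)"
  define \<omega> where "\<omega> = (\<Sum>i\<in>UNIV. \<Sum>j\<in>UNIV. trace (blk \<Delta> i j) * (norm (S i ** transpose (S j)))\<^sup>2)"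
  have "(p - 2 * d) * (n\<^sup>2 * d + \<tau>) + d * W + \<omega> \<le> (p - d) * (m + \<rho>)"
    using second_order_estimate[OF sym soc]
    unfolding n_def d_def p_def m_def \<rho>_def \<tau>_def W_def \<omega>_def .
  then have "(p - 2 * d) * (n\<^sup>2 * d - m) \<le> (p - d) * (\<rho> - \<tau>) + d * (m - W) + (d * \<tau> - \<omega>)"
    by (simp add: algebra_simps)
  moreover have "(p - 2 * d) * n * \<eta>\<^sup>2 / 2 \<le> (p - 2 * d) * (n\<^sup>2 * d - m)"
    using mult_left_mono[of "n * \<eta>\<^sup>2 / 2" "n\<^sup>2 * d - m" "p - 2 * d"] center p by (simp add: m_def)
  moreover have "(p - d) * (\<rho> - \<tau>) \<le> (p - d) * (2 * D * sqrt (n * d) * \<eta>)"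
    using abs_block_form_deviation_le[where S=S and \<Delta>=\<Delta>, OF S Q] p
    unfolding \<rho>_def \<tau>_def D_def n_def d_def \<eta>_def by (intro mult_left_mono) simp_all
  moreover have "d * (m - W) \<le> d\<^sup>2 * D\<^sup>2"
    using mult_left_mono[OF gram_deficit_le[OF soc], of d]
    unfolding m_def W_def d_def D_def by (simp add: power2_eq_square)
  moreover have "d * \<tau> - \<omega> \<le> 2 * sqrt 2 * t * sqrt (n * d) * \<eta>"
    using abs_gram_form_deviation_le[where S=S and \<Delta>=\<Delta>, OF S Q]
    unfolding \<tau>_def \<omega>_def t_def n_def d_def \<eta>_def by linarith
  ultimately show ?thesis
    by (simp only: ac_simps)
qed

lemma op_norm_partial_trace_le:
  "op_norm (partial_trace \<Delta>) \<le> max (op_norm (partial_trace \<Delta>) / op_norm \<Delta>) 1 * op_norm \<Delta>"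
proof (cases "op_norm \<Delta> = 0")
  case True
  then have "\<Delta> = 0"
    using onorm_eq_0[OF matrix_vector_mul_bounded_linear[of \<Delta>]]
    by (simp add: op_norm_def matrix_eq fun_eq_iff)
  then have "partial_trace \<Delta> = 0"
    by (simp add: partial_trace_def blk_def vec_eq_iff trace_def)
  then show ?thesis
    using True by (simp add: op_norm_def onorm_zero)
next
  case False
  then have "0 < op_norm \<Delta>"
    using onorm_pos_le[OF matrix_vector_mul_bounded_linear[of \<Delta>]] by (simp add: op_norm_def)
  then show ?thesis
    by (simp add: max_def field_simps)
qed

theorem proposition4:
  fixes \<Delta> :: "real^('n::finite \<times> 'd::finite)^('n \<times> 'd)"
    and S :: "'n \<Rightarrow> real^'p::finite^'d"
  assumes "CARD('p) \<ge> 2 * CARD('d) + 1"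
    and "transpose \<Delta> = \<Delta>"
    and "\<forall>i. blk \<Delta> i i = 0"
    and "second_order_critical \<Delta> S"
  shows "let \<gamma> = max (op_norm (partial_trace \<Delta>) / op_norm \<Delta>) 1;
             \<delta> = (2 + sqrt 5) * (real CARD('p) + real CARD('d)) * \<gamma>
                 / (real CARD('p) - 2 * real CARD('d))
         in dF S \<le> \<delta> * sqrt (real CARD('d) / real CARD('n)) * op_norm \<Delta>"
proof -
  have S: "\<And>i. S i ** transpose (S i) = mat 1"
    using assms(4) by (simp add: second_order_critical_def feasible_def)
  obtain k where center: "real CARD('n) * (L2_set (\<lambda>i. norm (S i - S k)) UNIV)\<^sup>2
      \<le> 2 * ((real CARD('n))\<^sup>2 * real CARD('d) - (norm (\<Sum>i\<in>UNIV. S i))\<^sup>2)"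
    using exists_center[where S=S, OF S] by blast
  have p: "2 * real CARD('d) < real CARD('p)"
    using assms(1) by linarith
  have "L2_set (\<lambda>i. norm (S i - S k)) UNIV
      \<le> (2 + sqrt 5) * (real CARD('p) + real CARD('d)) * max (op_norm (partial_trace \<Delta>) / op_norm \<Delta>) 1
        / (real CARD('p) - 2 * real CARD('d)) * sqrt (real CARD('d) / real CARD('n)) * op_norm \<Delta>"
    by (rule quadratic_estimate_imp_bound[OF _ _ p op_norm_nonneg _ op_norm_partial_trace_le
          L2_set_nonneg distance_quadratic_estimate[OF _ assms(2,4) S[of k] center]])
      (use p in simp_all)
  then show ?thesis
    using dF_le_L2_set[OF S[of k], of S] unfolding Let_def by linarith
qed

end
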